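(* Let $X$ be an order complete vector lattice, let $0<e\in X$, and let $x\in X_s$. Then the following statements are equivalent: (1) $x\in X_s\setminus X^u$; (2) $\inf_{\lambda\in(0,\infty)}P_{(x-\lambda e)^+}e>0$.
   Context: $X^u$ denotes the universal completion of $X$. For an order complete vector lattice $X$, $X_s$ denotes its sup-completion (Donner): the unique (up to isomorphism) order complete ordered cone (addition and multiplication by nonnegative scalars compatible with the order) such that: (P1) $X$ is the set of (additively) invertible elements of $X_s$, with coinciding algebraic and order structures; (P2) $y=\sup\{x\in X: x\le y\}$ for every $y\in X_s$; (P3) $x+(f\wedge y)=(x+f)\wedge(x+y)$ for $x,y\in X_s$, $f\in X$; and if $X$ has a weak order unit $e$, then $x=\sup_k(ke\wedge x)$ for all $0\le x\in X_s$; (P4) if $x\in X$, $y\in X_s$ and $y\le x$ then $y\in X$; (P5) $X_s$ has a biggest element; (P6) if $A,B\subset X_s$ are nonempty with $\sup A=\sup B$, then $\sup_{a\in A}(a\wedge x)=\sup_{b\in B}(b\wedge x)$ for every $x\in X$; in particular $(\sup A)\wedge x=\sup_{a\in A}(a\wedge x)$. An element $x\in X_s$ is regarded as belonging to $X^u$ when the set $\{y\in X:y\le x\}$ has a supremum in $X^u$ (with which $x$ is then identified); $X_s\setminus X^u$ is the set of the other elements of $X_s$. For $0\le a\in X_s$, $P_a$ is the band projection on $X$ defined by $P_a(z)=\sup_{n\in\mathbb N}(z\wedge na)$ for $z\in X_+$ and $P_a(z)=P_a(z^+)-P_a(z^-)$ for $z\in X$. For $x\in X_s$, $(x-\lambda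 e)^+=(x-\lambda e)\vee 0\in X_s$. The infimum in (2) is taken in $X$.
   Formalization: e is additionally assumed to be a weak order unit of X; for merely 0 < e the implication (1) ⇒ (2) fails, e.g. X = ℝ², e = (1,0), x = (0,∞). *)

theory Defs
  imports Complex_Main "HOL-Library.Lub_Glb"
begin

text \<open>
  An order complete vector lattice is a type of sort
  \<open>{ordered_real_vector, conditionally_complete_lattice}\<close>.
\<close>

text \<open>
  A merely positive \<open>e\<close> does not detect the part of an element that is disjoint from \<open>e\<close>: in
  \<open>\<real> \<times> \<real>\<close>, with \<open>e = (1, 0)\<close> and \<open>x = (0, \<infinity>)\<close>, the projection of \<open>e\<close> onto the band of
  \<open>(x - t e)\<^sup>+ = (0, \<infinity>)\<close> is \<open>0\<close> for all \<open>t > 0\<close>, although \<open>x\<close> is outside \<open>\<real> \<times> \<real>\<close>. Hence \<open>e\<close> is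
  required to be a weak order unit.
\<close>

definition weak_order_unit :: "'a::{ordered_real_vector, lattice} \<Rightarrow> bool" where
  "weak_order_unit e \<longleftrightarrow> 0 \<le> e \<and> (\<forall>x\<ge>0. inf x e = 0 \<longrightarrow> x = 0)"

text \<open>
  The sup-completion is characterized up to isomorphism by Donner's properties, so it is given as
  any type \<open>'b\<close> having them, with an embedding \<open>\<iota>\<close> of the vector lattice. The multiplication
  \<open>smul\<close> of the cone is only meaningful for nonnegative scalars. \<open>(P2)\<close> is stated with
  \<open>isLub\<close> rather than \<open>Sup\<close>, because \<open>Sup {}\<close> is unspecified in a conditionally complete
  lattice; the other suprema are of nonempty sets, which are bounded by \<open>(P5)\<close>.
\<close>

locale sup_completion =
  fixes \<iota> :: "'a::{ordered_real_vector, conditionally_complete_lattice} \<Rightarrow>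
               'b::{ordered_comm_monoid_add, conditionally_complete_lattice}"
    and smul :: "real \<Rightarrow> 'b \<Rightarrow> 'b"
  assumes smul_add_right: "0 \<le> r \<Longrightarrow> smul r (x + y) = smul r x + smul r y"
    and smul_add_left: "0 \<le> r \<Longrightarrow> 0 \<le> s \<Longrightarrow> smul (r + s) x = smul r x + smul s x"
    and smul_smul: "0 \<le> r \<Longrightarrow> 0 \<le> s \<Longrightarrow> smul r (smul s x) = smul (r * s) x"
    and smul_one: "smul 1 x = x"
    and smul_zero: "smul 0 x = 0"
    and smul_mono: "0 \<le> r \<Longrightarrow> x \<le> y \<Longrightarrow> smul r x \<le> smul r y"
    and P1_range: "range \<iota> = {y. \<exists>z. y + z = 0}"
    and P1_add: "\<iota> (f + g) = \<iota> f + \<iota> g"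
    and P1_scale: "0 \<le> r \<Longrightarrow> \<iota> (r *\<^sub>R f) = smul r (\<iota> f)"
    and P1_le: "\<iota> f \<le> \<iota> g \<longleftrightarrow> f \<le> g"
    and P2: "isLub UNIV (\<iota> ` {f. \<iota> f \<le> y}) y"
    and P3_inf: "x + inf (\<iota> f) y = inf (x + \<iota> f) (x + y)"
    and P3_unit: "weak_order_unit e \<Longrightarrow> 0 \<le> x \<Longrightarrow>
                   x = (SUP k::nat. inf (\<iota> (real k *\<^sub>R e)) x)"
    and P4: "y \<le> \<iota> f \<Longrightarrow> y \<in> range \<iota>"
    and P5: "\<exists>m. \<forall>y::'b. y \<le> m"
    and P6: "A \<noteq> {} \<Longrightarrow> B \<noteq> {} \<Longrightarrow> Sup A = Sup B \<Longrightarrow>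
              (SUP a\<in>A. inf a (\<iota> f)) = (SUP b\<in>B. inf b (\<iota> f))"

text \<open>
  The universal completion: a universally complete (order complete and laterally complete) vector
  lattice containing the given one, via \<open>\<kappa>\<close>, as an order dense sublattice.
\<close>

locale universal_completion =
  fixes \<kappa> :: "'a::{ordered_real_vector, conditionally_complete_lattice} \<Rightarrow>
               'c::{ordered_real_vector, conditionally_complete_lattice}"
  assumes linear_embedding: "linear \<kappa>"
    and inj_embedding: "inj \<kappa>"
    and sup_hom: "\<kappa> (sup f g) = sup (\<kappa> f) (\<kappa> g)"
    and inf_hom: "\<kappa> (inf f g) = inf (\<kappa> f) (\<kappa> g)"
    and order_dense: "0 < (u :: 'c) \<Longrightarrow> \<exists>f. 0 < \<kappa> f \<and> \<kappa> f \<le> u"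
    and laterally_complete:
      "(D :: 'c set) \<noteq> {} \<Longrightarrow> (\<And>u. u \<in> D \<Longrightarrow> 0 \<le> u) \<Longrightarrow>
       (\<And>u v. u \<in> D \<Longrightarrow> v \<in> D \<Longrightarrow> u \<noteq> v \<Longrightarrow> inf u v = 0) \<Longrightarrow> \<exists>s. isLub UNIV D s"

text \<open>
  Membership in \<open>X\<^sup>u\<close> of an element of the sup-completion: its minorants in \<open>X\<close> have a supremum
  in \<open>X\<^sup>u\<close>.
\<close>

definition in_universal_completion ::
  "('a \<Rightarrow> 'b::ord) \<Rightarrow> ('a \<Rightarrow> 'c::ord) \<Rightarrow> 'b \<Rightarrow> bool" where
  "in_universal_completion \<iota> \<kappa> x \<longleftrightarrow> (\<exists>u. isLub UNIV (\<kappa> ` {f. \<iota> f \<le> x}) u)"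

text \<open>
  For \<open>z \<ge> 0\<close>, the elements \<open>z \<and> n a\<close> lie below \<open>z\<close>, hence in the vector lattice by \<open>(P4)\<close>;
  \<open>inv \<iota>\<close> pulls them back there.
\<close>

definition band_proj_pos ::
  "('a::conditionally_complete_lattice \<Rightarrow> 'b::lattice) \<Rightarrow> (real \<Rightarrow> 'b \<Rightarrow> 'b) \<Rightarrow> 'b \<Rightarrow> 'a \<Rightarrow> 'a" where
  "band_proj_pos \<iota> smul a z = (SUP n::nat. inv \<iota> (inf (\<iota> z) (smul (real n) a)))"

definition band_proj ::
  "('a::{ordered_real_vector, conditionally_complete_lattice} \<Rightarrow> 'b::lattice) \<Rightarrow>
   (real \<Rightarrow> 'b \<Rightarrow> 'b) \<Rightarrow> 'b \<Rightarrow> 'a \<Rightarrow> 'a" where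
  "band_proj \<iota> smul a z =
     band_proj_pos \<iota> smul a (sup z 0) - band_proj_pos \<iota> smul a (sup (- z) 0)"

end

theory Submission
  imports Defs
begin

text \<open>
  Write \<open>q\<^sub>t\<close> for the band projection of \<open>e\<close> by \<open>(x - t e)\<^sup>+\<close>. It is the part of \<open>e\<close> on which \<open>x\<close>
  exceeds \<open>t e\<close>, so the infimum \<open>p\<close> of all \<open>q\<^sub>t\<close> is the part of \<open>e\<close> on which \<open>x\<close> is infinite. As
  the target of \<open>\<kappa>\<close> is order complete and every \<open>x\<close> has a minorant in the vector lattice, \<open>x\<close>
  belongs to the universal completion exactly if the minorants of \<open>x\<close> are bounded above there.

  If they are bounded, say by \<open>u\<close>, then \<open>p = 0\<close> by a Chebyshev inequality: \<open>t q\<^sub>t \<le> te \<and> x\<^sup>+\<close>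
  (\<open>band_proj_Chebyshev\<close>). By \<open>(P4)\<close> the right-hand side is in the vector lattice, and there it is
  below the positive part of a minorant of \<open>x\<close> (\<open>le_positive_part_of_minorant\<close>), so
  \<open>t \<kappa> p \<le> u\<^sup>+\<close> for all \<open>t > 0\<close>. A conditionally complete ordered vector space is Archimedean,
  whence \<open>p \<le> 0\<close>.

  If \<open>p = 0\<close>, put \<open>c\<^sub>0 = e\<close> and \<open>c\<^sub>n = q\<^sub>n\<close> for \<open>n \<ge> 1\<close>. The slices \<open>d\<^sub>n = c\<^sub>n - c\<^sub>n\<^sub>+\<^sub>1\<close> are pairwise
  disjoint components of \<open>e\<close>, and on \<open>d\<^sub>n\<close> every minorant of \<open>x\<close> is at most \<open>(n + 1) e\<close>. By lateral
  completeness the disjoint elements \<open>(n + 1) d\<^sub>n\<close> have a supremum \<open>u\<close> in the universal completion.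
  It bounds all minorants: an excess of a minorant over \<open>u\<close> would, by order density and
  because \<open>e\<close> is a weak unit, dominate some \<open>0 < g \<le> e\<close> in the vector lattice. This \<open>g\<close> is disjoint
  from each slice, hence lies below each \<open>c\<^sub>n\<close> and so below \<open>p = 0\<close>
  (\<open>no_infinite_part_imp_bounded\<close>).
\<close>

section \<open>Disjointness in lattice ordered groups\<close>

lemma inf_add_le_zero:
  fixes r y z :: "'a::{ordered_ab_group_add, lattice}"
  assumes "inf r y \<le> 0" and "inf r z \<le> 0" and "0 \<le> z"
  shows "inf r (y + z) \<le> 0"
proof -
  let ?w = "inf r (y + z)"
  have "?w - z \<le> y" by (simp add: diff_le_eq)
  moreover have "?w - z \<le> r"
    using assms(3) by (meson diff_le_eq inf.coboundedI1 le_add_same_cancel1 order_trans order_refl)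
  ultimately have "?w - z \<le> inf r y" by simp
  also have "\<dots> \<le> 0" by (rule assms(1))
  finally have "?w \<le> z" by simp
  then have "?w \<le> inf r z" by simp
  also have "\<dots> \<le> 0" by (rule assms(2))
  finally show ?thesis .
qed

lemma inf_scaleR_of_nat_le_zero:
  fixes r y :: "'a::{ordered_real_vector, lattice}"
  assumes "inf r y \<le> 0" and "0 \<le> y"
  shows "inf r (real n *\<^sub>R y) \<le> 0"
proof (induction n)
  case 0
  show ?case by simp
next
  case (Suc n)
  then have "inf r (real n *\<^sub>R y + y) \<le> 0" using assms by (intro inf_add_le_zero) auto
  then show ?case by (simp add: algebra_simps)
qed

lemma add_le_of_disjoint:
  fixes x y z :: "'a::{ordered_ab_group_add, lattice}"
  assumes "x \<le> z" and "y \<le> z" and "inf x y \<le> 0"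
  shows "x + y \<le> z"
proof -
  have "x + y - z \<le> x" "x + y - z \<le> y" using assms by (simp_all add: diff_le_eq add_mono)
  then have "x + y - z \<le> inf x y" by simp
  also have "\<dots> \<le> 0" by (rule assms(3))
  finally show ?thesis by simp
qed

lemma inf_le_zero_mono:
  fixes r y r' y' :: "'a::{zero, lattice}"
  assumes "inf r y \<le> 0" and "r' \<le> r" and "y' \<le> y"
  shows "inf r' y' \<le> 0"
  using inf_mono[OF assms(2,3)] assms(1) by (rule order_trans)

text \<open>The least upper bound \<open>s\<close> of all multiples of \<open>p\<close> satisfies \<open>s + p \<le> s\<close>.\<close>

lemma conditionally_complete_archimedean:
  fixes p v :: "'a::{ordered_real_vector, conditionally_complete_lattice}"
  assumes "\<And>n. real n *\<^sub>R p \<le> v"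
  shows "p \<le> 0"
proof -
  let ?s = "SUP n. real n *\<^sub>R p"
  have bdd: "bdd_above (range (\<lambda>n. real n *\<^sub>R p))" using assms by (auto simp: bdd_above_def)
  have "real n *\<^sub>R p \<le> ?s - p" for n
  proof -
    have "real (Suc n) *\<^sub>R p \<le> ?s" by (rule cSUP_upper[OF _ bdd]) simp
    then show ?thesis by (simp add: algebra_simps)
  qed
  then have "?s \<le> ?s - p" by (intro cSUP_least) auto
  then show ?thesis by simp
qed

section \<open>Slicing a weak unit along a decreasing chain of components\<close>

locale component_chain =
  fixes e :: "'a::{ordered_real_vector, lattice}" and c :: "nat \<Rightarrow> 'a"
  assumes chain_0: "c 0 = e"
    and chain_Suc: "c (Suc n) \<le> c n"
    and chain_nonneg: "0 \<le> c n"
    and chain_component: "inf (e - c n) (c n) \<le> 0"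
begin

definition slice :: "nat \<Rightarrow> 'a" where
  "slice n = c n - c (Suc n)"

lemma chain_antimono: "m \<le> n \<Longrightarrow> c n \<le> c m"
  using chain_Suc by (rule lift_Suc_antimono_le)

lemma chain_le_unit: "c n \<le> e"
  using chain_antimono[of 0 n] by (simp add: chain_0)

lemma slice_nonneg: "0 \<le> slice n"
  by (simp add: slice_def chain_Suc)

lemma slice_le_chain: "slice n \<le> c n"
  by (simp add: slice_def chain_nonneg)

lemma slice_le_unit_diff_chain: "slice n \<le> e - c (Suc n)"
  by (simp add: slice_def chain_le_unit)

lemma slice_le_unit: "slice n \<le> e"
  using slice_le_chain chain_le_unit by (rule order_trans)

lemma slices_disjoint:
  assumes "m \<noteq> n"
  shows "inf (slice m) (slice n) \<le> 0"
proof -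
  have less: "inf (slice i) (slice j) \<le> 0" if "i < j" for i j
  proof -
    have "slice j \<le> c (Suc i)"
      using slice_le_chain chain_antimono[of "Suc i" j] that by (meson Suc_leI order_trans)
    then show ?thesis by (rule inf_le_zero_mono[OF chain_component slice_le_unit_diff_chain])
  qed
  show ?thesis using less[of m n] less[of n m] assms by (metis inf_commute linorder_neqE_nat)
qed

lemma slice_component: "inf (slice n) (e - slice n) \<le> 0"
proof -
  have "inf (slice n) (e - c n) \<le> 0"
    using inf_le_zero_mono[OF chain_component[of n] order_refl slice_le_chain]
    by (simp add: inf_commute)
  moreover have "inf (slice n) (c (Suc n)) \<le> 0"
    by (rule inf_le_zero_mono[OF chain_component slice_le_unit_diff_chain order_refl])
  ultimately have "inf (slice n) (e - c n + c (Suc n)) \<le> 0"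
    by (intro inf_add_le_zero chain_nonneg)
  then show ?thesis by (simp add: slice_def algebra_simps)
qed

text \<open>The first \<open>n\<close> slices add up to \<open>e - c n\<close>.\<close>

lemma le_chain_of_disjoint_slices:
  assumes "0 \<le> g" and "g \<le> e" and disj: "\<And>n. inf g (slice n) \<le> 0"
  shows "g \<le> c n"
proof -
  have "inf g (e - c n) \<le> 0"
  proof (induction n)
    case 0
    show ?case by (simp add: chain_0)
  next
    case (Suc n)
    then have "inf g (e - c n + slice n) \<le> 0" by (intro inf_add_le_zero disj slice_nonneg)
    then show ?case by (simp add: slice_def)
  qed
  moreover have "g - c n \<le> g" "g - c n \<le> e - c n"
    using chain_nonneg[of n] assms(2) by simp_all
  ultimately have "g - c n \<le> 0" by (meson le_inf_iff order_trans)
  then show ?thesis by simp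
qed

end

section \<open>Band projections in the sup-completion\<close>

context sup_completion
begin

lemma emb_zero: "\<iota> 0 = 0"
  using P1_scale[of 0 0] by (simp add: smul_zero)

lemma emb_mono: "f \<le> g \<Longrightarrow> \<iota> f \<le> \<iota> g"
  by (simp add: P1_le)

lemma emb_le_zero_iff: "\<iota> f \<le> 0 \<longleftrightarrow> f \<le> 0"
  using P1_le[of f 0] by (simp add: emb_zero)

lemma emb_nonneg: "0 \<le> f \<Longrightarrow> 0 \<le> \<iota> f"
  using P1_le[of 0 f] by (simp add: emb_zero)

lemma emb_add_cancel: "\<iota> f + y \<le> \<iota> f + z \<longleftrightarrow> y \<le> z"
proof
  assume "\<iota> f + y \<le> \<iota> f + z"
  then have "\<iota> (- f) + (\<iota> f + y) \<le> \<iota> (- f) + (\<iota> f + z)" by (rule add_left_mono)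
  then show "y \<le> z" by (simp add: add.assoc[symmetric] P1_add[symmetric] emb_zero)
qed (rule add_left_mono)

lemma below_embE:
  assumes "y \<le> \<iota> f"
  obtains g where "y = \<iota> g" and "g \<le> f"
  using P4[OF assms] assms by (auto simp: P1_le)

lemma emb_inf: "\<iota> (inf f g) = inf (\<iota> f) (\<iota> g)"
proof (rule antisym)
  obtain k where k: "inf (\<iota> f) (\<iota> g) = \<iota> k" by (rule below_embE[OF inf_le1])
  have "k \<le> f" "k \<le> g" using inf_le1[of "\<iota> f" "\<iota> g"] inf_le2[of "\<iota> f" "\<iota> g"]
    by (simp_all add: k P1_le)
  then show "inf (\<iota> f) (\<iota> g) \<le> \<iota> (inf f g)" by (simp add: k P1_le)
qed (simp add: P1_le)

lemma smul_zero_right: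
  assumes "0 \<le> r"
  shows "smul r 0 = 0"
  using smul_smul[OF assms, of 0 0] by (simp add: smul_zero)

lemma smul_nonneg: "0 \<le> r \<Longrightarrow> 0 \<le> a \<Longrightarrow> 0 \<le> smul r a"
  using smul_mono[of r 0 a] by (simp add: smul_zero_right)

lemma smul_mono_scalar:
  assumes "0 \<le> r" and "r \<le> s" and "0 \<le> a"
  shows "smul r a \<le> smul s a"
proof -
  have "smul r a + 0 \<le> smul r a + smul (s - r) a"
    using assms by (intro add_left_mono smul_nonneg) auto
  also have "\<dots> = smul s a" using smul_add_left[of r "s - r" a] assms by simp
  finally show ?thesis by simp
qed

text \<open>
  Dividing by a scalar \<open>t \<ge> 1\<close> shrinks \<open>r \<ge> 0\<close>, so \<open>(r \<and> t a) / t \<le> r \<and> a\<close>; smaller scalars only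
  make \<open>t a\<close> smaller.
\<close>

lemma inf_smul_le_zero:
  assumes "inf (\<iota> r) a \<le> 0" and "0 \<le> r" and "0 \<le> a" and "0 \<le> s"
  shows "inf (\<iota> r) (smul s a) \<le> 0"
proof -
  define t where "t = max s 1"
  have t: "1 \<le> t" "s \<le> t" by (simp_all add: t_def)
  let ?y = "inf (\<iota> r) (smul t a)"
  have "smul (1 / t) ?y \<le> smul (1 / t) (\<iota> r)" using t by (intro smul_mono) auto
  also have "\<dots> \<le> smul 1 (\<iota> r)" using t assms(2) by (intro smul_mono_scalar emb_nonneg) auto
  finally have "smul (1 / t) ?y \<le> \<iota> r" by (simp add: smul_one)
  moreover have "smul (1 / t) ?y \<le> a"
  proof -
    have "smul (1 / t) ?y \<le> smul (1 / t) (smul t a)" using t by (intro smul_mono) auto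
    also have "\<dots> = a" using t by (simp add: smul_smul smul_one)
    finally show ?thesis .
  qed
  ultimately have "smul (1 / t) ?y \<le> 0" using assms(1) by (meson le_inf_iff order_trans)
  then have "smul t (smul (1 / t) ?y) \<le> smul t 0" using t by (intro smul_mono) auto
  then have "?y \<le> 0" using t by (simp add: smul_smul smul_one smul_zero_right)
  moreover have "inf (\<iota> r) (smul s a) \<le> ?y"
    using t assms by (intro inf_mono order_refl smul_mono_scalar)
  ultimately show ?thesis by (rule order_trans[rotated])
qed

lemma band_proj_eq_SUP:
  assumes "0 \<le> a" and "0 \<le> z"
  shows "band_proj \<iota> smul a z = (SUP n::nat. inv \<iota> (inf (\<iota> z) (smul (real n) a)))"
proof -
  have inj: "inj \<iota>" by (rule injI) (metis P1_le antisym order_refl)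
  have "inv \<iota> 0 = 0" using inv_f_f[OF inj, of 0] by (simp add: emb_zero)
  moreover have "inf 0 (smul (real n) a) = 0" for n
    using smul_nonneg[of "real n" a] assms(1) by (simp add: inf_absorb1)
  ultimately have "band_proj_pos \<iota> smul a 0 = 0"
    by (simp add: band_proj_pos_def emb_zero)
  moreover have "sup z 0 = z" "sup (- z) 0 = 0"
    using assms(2) by (simp_all add: sup_absorb1 sup_absorb2)
  ultimately show ?thesis by (simp add: band_proj_def) (simp add: band_proj_pos_def)
qed

lemma emb_inv_below: "y \<le> \<iota> f \<Longrightarrow> \<iota> (inv \<iota> y) = y"
  using P4 by (rule f_inv_into_f)

lemma inf_smul_le_band_proj:
  assumes "0 \<le> a" and "0 \<le> z"
  shows "inf (\<iota> z) (smul (real n) a) \<le> \<iota> (band_proj \<iota> smul a z)"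
proof -
  have emb: "\<iota> (inv \<iota> (inf (\<iota> z) (smul (real n) a))) = inf (\<iota> z) (smul (real n) a)" for n
    by (rule emb_inv_below[OF inf_le1])
  have "inv \<iota> (inf (\<iota> z) (smul (real n) a)) \<le> z" for n
    using P1_le emb inf_le1 by metis
  then have "bdd_above (range (\<lambda>n. inv \<iota> (inf (\<iota> z) (smul (real n) a))))"
    by (auto simp: bdd_above_def)
  then have "inv \<iota> (inf (\<iota> z) (smul (real n) a)) \<le> band_proj \<iota> smul a z"
    unfolding band_proj_eq_SUP[OF assms] by (intro cSUP_upper) auto
  then show ?thesis using emb emb_mono by metis
qed

lemma band_proj_least:
  assumes "0 \<le> a" and "0 \<le> z" and "\<And>n::nat. inf (\<iota> z) (smul (real n) a) \<le> \<iota> v"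
  shows "band_proj \<iota> smul a z \<le> v"
  unfolding band_proj_eq_SUP[OF assms(1,2)]
proof (rule cSUP_least)
  fix n :: nat
  show "inv \<iota> (inf (\<iota> z) (smul (real n) a)) \<le> v"
    using assms(3)[of n] emb_inv_below[OF inf_le1] P1_le by metis
qed simp

lemma band_proj_le: "0 \<le> a \<Longrightarrow> 0 \<le> z \<Longrightarrow> band_proj \<iota> smul a z \<le> z"
  by (rule band_proj_least) auto

lemma band_proj_nonneg:
  assumes "0 \<le> a" and "0 \<le> z"
  shows "0 \<le> band_proj \<iota> smul a z"
proof -
  have "0 = inf (\<iota> z) (smul (real 0) a)"
    using emb_nonneg[OF assms(2)] by (simp add: smul_zero inf_absorb2)
  also have "\<dots> \<le> \<iota> (band_proj \<iota> smul a z)" by (rule inf_smul_le_band_proj[OF assms])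
  finally have "\<iota> 0 \<le> \<iota> (band_proj \<iota> smul a z)" by (simp add: emb_zero)
  then show ?thesis by (simp add: P1_le)
qed

lemma band_proj_mono:
  assumes "0 \<le> a" and "a \<le> b" and "0 \<le> z"
  shows "band_proj \<iota> smul a z \<le> band_proj \<iota> smul b z"
proof (rule band_proj_least[OF assms(1,3)])
  fix n :: nat
  have "inf (\<iota> z) (smul (real n) a) \<le> inf (\<iota> z) (smul (real n) b)"
    using assms(2) by (intro inf_mono order_refl smul_mono) auto
  also have "\<dots> \<le> \<iota> (band_proj \<iota> smul b z)"
    using assms by (intro inf_smul_le_band_proj) auto
  finally show "inf (\<iota> z) (smul (real n) a) \<le> \<iota> (band_proj \<iota> smul b z)" .
qed

text \<open>
  Adding \<open>(z - P z) \<and> k a\<close> to \<open>z \<and> n a\<close> gives an element below \<open>z \<and> (n + k) a\<close>, hence below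
  \<open>P z\<close>; so \<open>P z\<close> absorbs \<open>(z - P z) \<and> k a\<close>.
\<close>

lemma band_proj_complement_disjoint_smul:
  assumes "0 \<le> a" and "0 \<le> z"
  shows "inf (\<iota> (z - band_proj \<iota> smul a z)) (smul (real k) a) \<le> 0"
proof -
  let ?p = "band_proj \<iota> smul a z"
  obtain w where w: "inf (\<iota> (z - ?p)) (smul (real k) a) = \<iota> w" and wle: "w \<le> z - ?p"
    by (rule below_embE[OF inf_le1])
  have "?p \<le> ?p - w"
  proof (rule band_proj_least[OF assms])
    fix n :: nat
    obtain y where y: "inf (\<iota> z) (smul (real n) a) = \<iota> y" by (rule below_embE[OF inf_le1])
    have "y \<le> ?p" using inf_smul_le_band_proj[OF assms, of n] by (simp add: y P1_le)
    then have "y + w \<le> ?p + (z - ?p)" using wle by (rule add_mono)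
    then have "\<iota> y + \<iota> w \<le> \<iota> z" by (simp add: P1_add[symmetric] P1_le)
    moreover have "\<iota> y + \<iota> w \<le> smul (real n) a + smul (real k) a"
      unfolding w[symmetric] y[symmetric] by (intro add_mono inf_le2)
    ultimately have "\<iota> y + \<iota> w \<le> inf (\<iota> z) (smul (real (n + k)) a)"
      by (simp add: smul_add_left)
    also have "\<dots> \<le> \<iota> ?p" by (rule inf_smul_le_band_proj[OF assms])
    finally have "y + w \<le> ?p" by (simp add: P1_add[symmetric] P1_le)
    then have "y \<le> ?p - w" by (simp add: algebra_simps)
    then show "inf (\<iota> z) (smul (real n) a) \<le> \<iota> (?p - w)" by (simp add: y P1_le)
  qed
  then show ?thesis by (simp add: w emb_le_zero_iff)
qed

lemma band_proj_complement_disjoint: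
  assumes "0 \<le> a" and "0 \<le> z"
  shows "inf (\<iota> (z - band_proj \<iota> smul a z)) a \<le> 0"
  using band_proj_complement_disjoint_smul[OF assms, of 1] by (simp add: smul_one)

lemma band_proj_component:
  assumes "0 \<le> a" and "0 \<le> z"
  shows "inf (z - band_proj \<iota> smul a z) (band_proj \<iota> smul a z) \<le> 0"
proof -
  let ?p = "band_proj \<iota> smul a z"
  let ?w = "inf (z - ?p) ?p"
  have "?p \<le> ?p - ?w"
  proof (rule band_proj_least[OF assms])
    fix n :: nat
    obtain y where y: "inf (\<iota> z) (smul (real n) a) = \<iota> y" by (rule below_embE[OF inf_le1])
    have "y \<le> ?p" using inf_smul_le_band_proj[OF assms, of n] by (simp add: y P1_le)
    moreover have "inf y ?w \<le> 0"
    proof -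
      have "\<iota> (inf y ?w) \<le> inf (\<iota> (z - ?p)) (smul (real n) a)"
        unfolding emb_inf y[symmetric] by (simp add: le_infI1 le_infI2)
      also have "\<dots> \<le> 0" by (rule band_proj_complement_disjoint_smul[OF assms])
      finally show ?thesis by (simp only: emb_le_zero_iff)
    qed
    ultimately have "y + ?w \<le> ?p" by (intro add_le_of_disjoint) auto
    then have "y \<le> ?p - ?w" by (simp add: le_diff_eq)
    then show "inf (\<iota> z) (smul (real n) a) \<le> \<iota> (?p - ?w)" by (simp add: y P1_le)
  qed
  then show ?thesis by simp
qed

section \<open>Level sets of an element of the sup-completion\<close>

abbreviation excess :: "'b \<Rightarrow> 'a \<Rightarrow> real \<Rightarrow> 'b" where
  "excess x e t \<equiv> sup (x + \<iota> (- (t *\<^sub>R e))) 0"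

abbreviation level :: "'b \<Rightarrow> 'a \<Rightarrow> real \<Rightarrow> 'a" where
  "level x e t \<equiv> band_proj \<iota> smul (excess x e t) e"

lemma level_antimono:
  assumes "0 \<le> e" and "s \<le> t"
  shows "level x e t \<le> level x e s"
proof (rule band_proj_mono)
  have "\<iota> (- (t *\<^sub>R e)) \<le> \<iota> (- (s *\<^sub>R e))"
    using assms by (intro emb_mono) (simp add: scaleR_right_mono)
  then show "excess x e t \<le> excess x e s" by (intro sup_mono add_left_mono order_refl)
qed (use assms in auto)

text \<open>
  With \<open>c = te \<and> x\<^sup>+\<close>, the gap \<open>te - c = (te - x)\<^sup>+\<close> is disjoint from \<open>(x - te)\<^sup>+\<close>. Every
  \<open>e \<and> n (x - te)\<^sup>+\<close> is below a multiple of \<open>(x - te)\<^sup>+\<close>, and the part of its \<open>t\<close>-fold that exceeds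
  \<open>c\<close> is below that gap, so there is no such part.
\<close>

lemma band_proj_Chebyshev:
  assumes "0 \<le> e" and "0 < t"
  shows "\<iota> (t *\<^sub>R level x e t) \<le> inf (\<iota> (t *\<^sub>R e)) (sup x 0)"
proof -
  let ?a = "excess x e t"
  obtain c where c: "inf (\<iota> (t *\<^sub>R e)) (sup x 0) = \<iota> c" and cle: "c \<le> t *\<^sub>R e"
    by (rule below_embE[OF inf_le1])
  have cx: "\<iota> c \<le> sup x 0" unfolding c[symmetric] by simp
  have "0 \<le> t *\<^sub>R e" using assms by (intro scaleR_nonneg_nonneg) auto
  then have "0 \<le> inf (\<iota> (t *\<^sub>R e)) (sup x 0)" by (simp add: emb_nonneg)
  then have c0: "0 \<le> c" using P1_le[of 0 c] by (simp add: c emb_zero)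
  \<comment> \<open>Invertible elements such as \<open>\<iota> c\<close> can be moved to the other side of an inequality, where
    the supremum \<open>(x - te)\<^sup>+\<close> is bounded argument by argument.\<close>
  have "?a \<le> \<iota> (- c) + sup x 0"
  proof (rule sup_least)
    have "x + \<iota> (- (t *\<^sub>R e)) \<le> sup x 0 + \<iota> (- c)"
      using cle by (intro add_mono emb_mono) auto
    then show "x + \<iota> (- (t *\<^sub>R e)) \<le> \<iota> (- c) + sup x 0" by (simp add: add.commute)
    show "0 \<le> \<iota> (- c) + sup x 0"
      using add_left_mono[OF cx, of "\<iota> (- c)"] by (simp add: P1_add[symmetric] emb_zero)
  qed
  then have "\<iota> c + ?a \<le> \<iota> c + (\<iota> (- c) + sup x 0)" by (rule add_left_mono)
  then have "\<iota> c + ?a \<le> sup x 0"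
    by (simp add: add.assoc[symmetric] P1_add[symmetric] emb_zero)
  then have "inf (\<iota> (t *\<^sub>R e)) (\<iota> c + ?a) \<le> inf (\<iota> (t *\<^sub>R e)) (sup x 0)" by (intro inf_mono) auto
  also have "\<dots> = \<iota> c + 0" by (simp add: c)
  finally have "\<iota> c + inf (\<iota> (t *\<^sub>R e - c)) ?a \<le> \<iota> c + 0"
    by (simp add: P3_inf P1_add[symmetric])
  then have gap: "inf (\<iota> (t *\<^sub>R e - c)) ?a \<le> 0" by (simp only: emb_add_cancel)
  have "level x e t \<le> (1 / t) *\<^sub>R c"
  proof (rule band_proj_least)
    fix n :: nat
    obtain y where y: "inf (\<iota> e) (smul (real n) ?a) = \<iota> y" and yle: "y \<le> e"
      by (rule below_embE[OF inf_le1])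
    have ya: "\<iota> y \<le> smul (real n) ?a" unfolding y[symmetric] by simp
    let ?h = "sup (t *\<^sub>R y - c) 0"
    have "0 \<le> inf (\<iota> e) (smul (real n) ?a)"
      using assms(1) by (simp add: emb_nonneg smul_nonneg)
    then have y0: "0 \<le> y" using P1_le[of 0 y] by (simp add: y emb_zero)
    have "?h \<le> t *\<^sub>R e - c"
      using yle cle assms(2) by (simp add: scaleR_left_mono)
    moreover have "?h \<le> t *\<^sub>R y" using c0 y0 assms(2) by (simp add: scaleR_nonneg_nonneg)
    then have "\<iota> ?h \<le> smul t (\<iota> y)" using assms(2) by (simp add: P1_scale[symmetric] P1_le)
    then have "\<iota> ?h \<le> smul (t * real n) ?a"
      using smul_mono[OF _ ya, of t] assms(2) by (simp add: smul_smul)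
    ultimately have "\<iota> ?h \<le> inf (\<iota> (t *\<^sub>R e - c)) (smul (t * real n) ?a)"
      by (simp add: P1_le)
    also have "\<dots> \<le> 0" using gap cle assms(2) by (intro inf_smul_le_zero) auto
    finally have "?h \<le> 0" by (simp only: emb_le_zero_iff)
    then have "t *\<^sub>R y \<le> c" by simp
    then have "(1 / t) *\<^sub>R (t *\<^sub>R y) \<le> (1 / t) *\<^sub>R c" using assms(2) by (intro scaleR_left_mono) auto
    then show "inf (\<iota> e) (smul (real n) ?a) \<le> \<iota> ((1 / t) *\<^sub>R c)"
      using assms(2) by (simp add: y P1_le)
  qed (use assms in auto)
  then have "t *\<^sub>R level x e t \<le> t *\<^sub>R ((1 / t) *\<^sub>R c)" using assms(2) by (intro scaleR_left_mono) auto
  then show ?thesis using assms(2) by (simp add: c P1_le)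
qed

text \<open>The minorant is \<open>c \<and> x\<close>; the lattice distributivity needed for it is an instance of \<open>(P6)\<close>.\<close>

lemma le_positive_part_of_minorant:
  assumes "\<iota> c \<le> sup x 0"
  obtains f where "\<iota> f \<le> x" and "c \<le> sup f 0"
proof -
  obtain f where f: "inf (\<iota> c) x = \<iota> f" by (rule below_embE[OF inf_le1])
  have fx: "\<iota> f \<le> x" unfolding f[symmetric] by simp
  have "(SUP a\<in>{x, 0}. inf a (\<iota> c)) = (SUP b\<in>{sup x 0}. inf b (\<iota> c))"
    by (rule P6) (auto simp: cSup_insert)
  then have "sup (inf x (\<iota> c)) (inf 0 (\<iota> c)) = inf (sup x 0) (\<iota> c)"
    by (simp add: cSup_insert)
  also have "\<dots> = \<iota> c" using assms by (simp add: inf_absorb2)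
  finally have "\<iota> c = sup (\<iota> f) (inf 0 (\<iota> c))" by (simp add: f[symmetric] inf_commute)
  also have "\<dots> \<le> \<iota> (sup f 0)"
    using emb_mono[of 0 "sup f 0"] by (simp add: P1_le emb_zero le_infI1)
  finally have "c \<le> sup f 0" by (simp only: P1_le)
  with fx show thesis by (rule that)
qed

text \<open>
  By \<open>(P2)\<close>, an element without minorants would be the least one; by \<open>(P4)\<close> it would then lie in the
  vector lattice and be its own minorant.
\<close>

lemma minorant_exists: "\<exists>f. \<iota> f \<le> x"
proof (rule ccontr)
  assume none: "\<nexists>f. \<iota> f \<le> x"
  then have "{f. \<iota> f \<le> x} = {}" by auto
  then have "x \<le> \<iota> 0" using P2[of x] by (auto simp: isLub_def leastP_def isUb_def setle_def setge_def)
  then obtain g where "x = \<iota> g" by (rule below_embE)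
  with none show False by auto
qed

lemma minorant_le_on_complement_of_level:
  assumes "\<iota> f \<le> x" and "0 \<le> e"
  shows "inf (e - level x e t) (sup (f - t *\<^sub>R e) 0) \<le> 0"
proof -
  have "\<iota> (f - t *\<^sub>R e) = \<iota> f + \<iota> (- (t *\<^sub>R e))" by (simp add: P1_add[symmetric])
  also have "\<dots> \<le> x + \<iota> (- (t *\<^sub>R e))" using assms(1) by (rule add_right_mono)
  finally have le: "\<iota> (f - t *\<^sub>R e) \<le> excess x e t" by (rule le_supI1)
  let ?y = "inf (e - level x e t) (sup (f - t *\<^sub>R e) 0)"
  have "\<iota> (sup (f - t *\<^sub>R e) 0) \<le> excess x e t"
  proof -
    \<comment> \<open>\<open>(x - te)\<^sup>+\<close> need not be in the range of \<open>\<iota>\<close>, but its infimum with an element of the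
      range is, by \<open>(P4)\<close>, and can be compared with the supremum taken in the vector lattice.\<close>
    obtain g where g: "inf (\<iota> (sup (f - t *\<^sub>R e) 0)) (excess x e t) = \<iota> g"
      by (rule below_embE[OF inf_le1])
    have "\<iota> (f - t *\<^sub>R e) \<le> \<iota> g" unfolding g[symmetric] using le by (simp add: P1_le)
    moreover have "\<iota> 0 \<le> \<iota> g"
      unfolding g[symmetric] by (intro le_infI emb_mono) (simp_all add: emb_zero)
    ultimately have "sup (f - t *\<^sub>R e) 0 \<le> g" by (simp add: P1_le)
    then have "\<iota> (sup (f - t *\<^sub>R e) 0) \<le> \<iota> g" by (rule emb_mono)
    also have "\<iota> g \<le> excess x e t" unfolding g[symmetric] by simp
    finally show ?thesis .
  qed
  then have "\<iota> ?y \<le> inf (\<iota> (e - level x e t)) (excess x e t)"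
    unfolding emb_inf by (intro inf_mono order_refl)
  also have "\<dots> \<le> 0" using assms(2) by (intro band_proj_complement_disjoint) auto
  finally show ?thesis by (simp only: emb_le_zero_iff)
qed

end

section \<open>Membership in the universal completion\<close>

lemma (in universal_completion) le_iff: "\<kappa> f \<le> \<kappa> g \<longleftrightarrow> f \<le> g"
  by (metis inf.absorb_iff1 inf_hom inj_embedding injD)

locale completions = sup_completion \<iota> smul + universal_completion \<kappa>
  for \<iota> :: "'a::{ordered_real_vector, conditionally_complete_lattice} \<Rightarrow>
               'b::{ordered_comm_monoid_add, conditionally_complete_lattice}"
    and smul :: "real \<Rightarrow> 'b \<Rightarrow> 'b"
    and \<kappa> :: "'a \<Rightarrow> 'c::{ordered_real_vector, conditionally_complete_lattice}"
begin

lemma in_universal_completion_iff_bounded: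
  "in_universal_completion \<iota> \<kappa> x \<longleftrightarrow> (\<exists>u. \<forall>f. \<iota> f \<le> x \<longrightarrow> \<kappa> f \<le> u)"
proof
  assume "in_universal_completion \<iota> \<kappa> x"
  then show "\<exists>u. \<forall>f. \<iota> f \<le> x \<longrightarrow> \<kappa> f \<le> u"
    by (auto simp: in_universal_completion_def isLub_def leastP_def isUb_def setle_def)
next
  let ?S = "\<kappa> ` {f. \<iota> f \<le> x}"
  assume "\<exists>u. \<forall>f. \<iota> f \<le> x \<longrightarrow> \<kappa> f \<le> u"
  then have "bdd_above ?S" by (auto simp: bdd_above_def)
  moreover have "?S \<noteq> {}" using minorant_exists by auto
  ultimately have "isLub UNIV ?S (Sup ?S)"
    by (intro isLubI2) (auto simp: setle_def setge_def isUb_def intro: cSup_upper cSup_least)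
  then show "in_universal_completion \<iota> \<kappa> x" by (auto simp: in_universal_completion_def)
qed

lemma bounded_imp_no_infinite_part:
  assumes "0 \<le> e" and bound: "\<And>f. \<iota> f \<le> x \<Longrightarrow> \<kappa> f \<le> u"
    and p: "\<And>t. 0 < t \<Longrightarrow> p \<le> level x e t"
  shows "p \<le> 0"
proof -
  have kappa_zero: "\<kappa> 0 = 0" using linear_embedding by (rule linear_0)
  have "real n *\<^sub>R \<kappa> p \<le> sup u 0" for n
  proof (cases "n = 0")
    case False
    then have n: "0 < real n" by simp
    have "real n *\<^sub>R p \<le> real n *\<^sub>R level x e (real n)"
      using p[OF n] by (intro scaleR_left_mono) auto
    then have "\<iota> (real n *\<^sub>R p) \<le> \<iota> (real n *\<^sub>R level x e (real n))" by (rule emb_mono)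
    also have "\<dots> \<le> sup x 0" using band_proj_Chebyshev[OF assms(1) n, of x] by simp
    finally obtain f where f: "\<iota> f \<le> x" "real n *\<^sub>R p \<le> sup f 0"
      by (rule le_positive_part_of_minorant)
    have "real n *\<^sub>R \<kappa> p = \<kappa> (real n *\<^sub>R p)" using linear_embedding by (simp add: linear_cmul)
    also have "\<dots> \<le> \<kappa> (sup f 0)" using f(2) by (simp add: le_iff)
    also have "\<dots> = sup (\<kappa> f) 0" by (simp add: sup_hom kappa_zero)
    also have "\<dots> \<le> sup u 0" using bound[OF f(1)] by (intro sup_mono order_refl)
    finally show ?thesis .
  qed simp
  then have "\<kappa> p \<le> \<kappa> 0" unfolding kappa_zero by (rule conditionally_complete_archimedean)
  then show ?thesis by (simp only: le_iff)
qed

text \<open>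
  This is the construction of the bound out of the slices. If a minorant \<open>f\<close> is not below \<open>u\<close>, order
  density yields \<open>g\<close> with \<open>0 < \<kappa> g \<le> (\<kappa> f - u)\<^sup>+\<close>. Below a slice \<open>d\<^sub>n\<close> this \<open>g\<close> vanishes,
  because \<open>(f - (n + 1) d\<^sub>n)\<^sup>+ \<le> (f - (n + 1) e)\<^sup>+ + (n + 1) (e - d\<^sub>n)\<close>
  and both summands are disjoint from \<open>d\<^sub>n\<close>.
\<close>

lemma no_infinite_part_imp_bounded:
  assumes unit: "weak_order_unit e"
    and no_inf: "\<And>g. 0 \<le> g \<Longrightarrow> (\<And>t. 0 < t \<Longrightarrow> g \<le> level x e t) \<Longrightarrow> g = 0"
  shows "\<exists>u. \<forall>f. \<iota> f \<le> x \<longrightarrow> \<kappa> f \<le> u"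
proof -
  have e0: "0 \<le> e" using unit by (simp add: weak_order_unit_def)
  have kappa_zero: "\<kappa> 0 = 0" using linear_embedding by (rule linear_0)
  define c where "c n = (if n = 0 then e else level x e (real n))" for n
  interpret component_chain e c
  proof
    fix n
    show "c (Suc n) \<le> c n"
      using e0 level_antimono[OF e0, of n "Suc n" x] by (auto simp: c_def band_proj_le)
    show "inf (e - c n) (c n) \<le> 0" using e0 by (auto simp: c_def band_proj_component)
  qed (use e0 in \<open>auto simp: c_def band_proj_nonneg\<close>)
  define b where "b n = real (Suc n) *\<^sub>R slice n" for n
  have b_nonneg: "0 \<le> b n" for n
    unfolding b_def by (intro scaleR_nonneg_nonneg slice_nonneg) simp
  have b_disjoint: "inf (b m) (b n) \<le> 0" if "m \<noteq> n" for m n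
  proof -
    have "inf (slice m) (b n) \<le> 0" unfolding b_def
      using slices_disjoint[OF that] slice_nonneg by (rule inf_scaleR_of_nat_le_zero)
    then have "inf (b n) (slice m) \<le> 0" by (simp add: inf_commute)
    then have "inf (b n) (b m) \<le> 0" unfolding b_def[of m]
      using slice_nonneg by (rule inf_scaleR_of_nat_le_zero)
    then show ?thesis by (simp add: inf_commute)
  qed
  have "\<exists>u. isLub UNIV (range (\<lambda>n. \<kappa> (b n))) u"
  proof (rule laterally_complete)
    show "0 \<le> w" if "w \<in> range (\<lambda>n. \<kappa> (b n))" for w
      using that le_iff[of 0] b_nonneg by (auto simp: kappa_zero)
    show "inf v w = 0" if vw: "v \<in> range (\<lambda>n. \<kappa> (b n))" "w \<in> range (\<lambda>n. \<kappa> (b n))" "v \<noteq> w" for v w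
    proof -
      obtain m n where mn: "v = \<kappa> (b m)" "w = \<kappa> (b n)" "m \<noteq> n" using vw by auto
      have "inf (b m) (b n) = 0" using b_disjoint[OF mn(3)] b_nonneg by (simp add: antisym)
      then show ?thesis using inf_hom[of "b m" "b n"] by (simp add: mn kappa_zero)
    qed
  qed simp
  then obtain u where u: "\<And>n. \<kappa> (b n) \<le> u"
    by (auto simp: isLub_def leastP_def isUb_def setle_def)
  have "\<kappa> f \<le> u" if f: "\<iota> f \<le> x" for f
  proof (rule ccontr)
    assume "\<not> \<kappa> f \<le> u"
    then have "0 < sup (\<kappa> f - u) 0" by (simp add: less_le_not_le)
    from order_dense[OF this] obtain g where g: "0 < \<kappa> g" "\<kappa> g \<le> sup (\<kappa> f - u) 0" by blast
    have g0: "0 \<le> g" using less_imp_le[OF g(1)] le_iff[of 0 g] by (simp add: kappa_zero)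
    have slice_disj: "inf g (slice n) \<le> 0" for n
    proof -
      let ?h = "inf g (slice n)" and ?t = "real (Suc n)"
      have "\<kappa> ?h \<le> \<kappa> g" by (simp add: le_iff)
      also note g(2)
      also have "sup (\<kappa> f - u) 0 \<le> sup (\<kappa> f - \<kappa> (b n)) 0"
        using u by (intro sup_mono order_refl diff_left_mono)
      also have "\<dots> = \<kappa> (sup (f - b n) 0)"
        using linear_diff[OF linear_embedding, of f "b n"] by (simp add: sup_hom kappa_zero)
      finally have "?h \<le> sup (f - b n) 0" by (simp only: le_iff)
      also have "\<dots> \<le> sup (f - ?t *\<^sub>R e) 0 + ?t *\<^sub>R (e - slice n)"
      proof (rule sup_least)
        have "f - b n = (f - ?t *\<^sub>R e) + ?t *\<^sub>R (e - slice n)"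
          by (simp only: b_def scaleR_diff_right) simp
        also have "\<dots> \<le> sup (f - ?t *\<^sub>R e) 0 + ?t *\<^sub>R (e - slice n)"
          by (rule add_right_mono) simp
        finally show "f - b n \<le> sup (f - ?t *\<^sub>R e) 0 + ?t *\<^sub>R (e - slice n)" .
        show "0 \<le> sup (f - ?t *\<^sub>R e) 0 + ?t *\<^sub>R (e - slice n)"
          by (intro add_nonneg_nonneg scaleR_nonneg_nonneg) (simp_all add: slice_le_unit)
      qed
      finally have le: "?h \<le> sup (f - ?t *\<^sub>R e) 0 + ?t *\<^sub>R (e - slice n)" .
      have h: "?h \<le> slice n" by simp
      have "slice n \<le> e - level x e ?t"
        using slice_le_unit_diff_chain[of n] by (simp add: c_def)
      then have "inf ?h (sup (f - ?t *\<^sub>R e) 0) \<le> 0"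
        by (rule inf_le_zero_mono[OF minorant_le_on_complement_of_level[OF f e0]
              order_trans[OF h] order_refl])
      moreover have "inf ?h (e - slice n) \<le> 0"
        by (rule inf_le_zero_mono[OF slice_component h order_refl])
      then have "inf ?h (?t *\<^sub>R (e - slice n)) \<le> 0"
        by (rule inf_scaleR_of_nat_le_zero) (simp add: slice_le_unit)
      ultimately have "inf ?h (sup (f - ?t *\<^sub>R e) 0 + ?t *\<^sub>R (e - slice n)) \<le> 0"
        by (rule inf_add_le_zero) (intro scaleR_nonneg_nonneg, simp_all add: slice_le_unit)
      then show ?thesis using le by (simp only: inf_absorb1)
    qed
    have "inf g e \<le> level x e t" if "0 < t" for t
    proof -
      obtain n where n: "t \<le> real (Suc n)"
        by (meson less_imp_le lessI of_nat_mono order_trans real_arch_simple)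
      have "inf g e \<le> c (Suc n)"
        using g0 e0 by (intro le_chain_of_disjoint_slices inf_le_zero_mono[OF slice_disj]) auto
      also have "\<dots> \<le> level x e t" using level_antimono[OF e0 n, of x] by (simp add: c_def)
      finally show ?thesis .
    qed
    then have "inf g e = 0" using g0 e0 by (intro no_inf) auto
    then have "g = 0" using unit g0 by (simp add: weak_order_unit_def)
    then show False using g(1) by (simp add: kappa_zero)
  qed
  then show ?thesis by blast
qed

end

theorem theorem11:
  fixes \<iota> :: "'a::{ordered_real_vector, conditionally_complete_lattice} \<Rightarrow>
               'b::{ordered_comm_monoid_add, conditionally_complete_lattice}"
    and smul :: "real \<Rightarrow> 'b \<Rightarrow> 'b"
    and \<kappa> :: "'a \<Rightarrow> 'c::{ordered_real_vector, conditionally_complete_lattice}"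
    and e :: 'a and x :: 'b
  assumes "sup_completion \<iota> smul"
    and "universal_completion \<kappa>"
    and "0 < e" and "weak_order_unit e"
  shows "\<not> in_universal_completion \<iota> \<kappa> x \<longleftrightarrow>
         (INF t\<in>{0::real<..}. band_proj \<iota> smul (sup (x + \<iota> (- (t *\<^sub>R e))) 0) e) > 0"
proof -
  interpret completions \<iota> smul \<kappa>
    using assms(1,2) by (simp add: completions_def)
  have e0: "0 \<le> e" using assms(3) by simp
  let ?p = "INF t\<in>{0::real<..}. level x e t"
  have level_nonneg: "0 \<le> level x e t" for t using e0 by (intro band_proj_nonneg) auto
  have p_le: "?p \<le> level x e t" if "0 < t" for t
    using that level_nonneg by (intro cINF_lower bdd_belowI[of _ 0]) auto
  have p_greatest: "g \<le> ?p" if "\<And>t. 0 < t \<Longrightarrow> g \<le> level x e t" for g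
    using that by (intro cINF_greatest) auto
  have "\<not> 0 < ?p" if bounded: "in_universal_completion \<iota> \<kappa> x"
  proof -
    obtain u where "\<And>f. \<iota> f \<le> x \<Longrightarrow> \<kappa> f \<le> u"
      using bounded unfolding in_universal_completion_iff_bounded by blast
    then have "?p \<le> 0" using p_le by (rule bounded_imp_no_infinite_part[OF e0])
    then show ?thesis by (simp add: less_le_not_le)
  qed
  moreover have "in_universal_completion \<iota> \<kappa> x" if "\<not> 0 < ?p"
  proof -
    have "0 \<le> ?p" by (rule p_greatest) (rule level_nonneg)
    then have "?p = 0" using that by (simp add: order_le_less)
    then have "g = 0" if "0 \<le> g" "\<And>t. 0 < t \<Longrightarrow> g \<le> level x e t" for g
      using p_greatest[OF that(2)] that(1) by (simp add: antisym)
    then show ?thesis unfolding in_universal_completion_iff_bounded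
      by (rule no_infinite_part_imp_bounded[OF assms(4)])
  qed
  ultimately show ?thesis by blast
qed

end
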